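(* Suppose that for each $i\in I$ there are $\theta_i\in(0,1]$ and a constant $H_i$ with $\|\nabla f_i(x)-\nabla f_i(y)\|\le H_i\|y-x\|^{\theta_i}$ for all $x,y\in\Omega$, and that for each $i\in I$ there exists $f_i^*\in\mathbb{R}$ such that $f_i(x)\ge f_i^*$ for all $x\in\Omega$. Let $\{x_k\}_{k\ge0}$ be a sequence generated by the Metropolis-Based Nonmonotone Line Search Method. Then either there exists $\bar k$ such that $d(x_{\bar k})=0$, or $$\liminf_{k\to+\infty}\|s(x_k)\|=0.$$
   Context: Setting: $\emptyset\ne\Omega\subset\mathbb{R}^n$ is closed and convex, $F=(f_1,\ldots,f_m)^T:\mathbb{R}^n\to\mathbb{R}^m$ is continuously differentiable (possibly nonconvex), $I=\{1,\ldots,m\}$, $\|\cdot\|$ is the Euclidean norm, $\mathbb{R}^m_+=\{z\in\mathbb{R}^m: z_i\ge0,\ i\in I\}$. For $x\in\Omega$, $\Omega-x=\{y\in\mathbb{R}^n: y+x\in\Omega\}$, and $s(x)$ is the unique minimizer over $d\in\Omega-x$ of $\max_{i\in I}\{\nabla f_i(x)^Td\}+\frac12\|d\|^2$. Metropolis-Based Nonmonotone Line Search Method. Parameters: $x_0\in\Omega$, $\beta,\rho\in(0,1)$, $c_1,c_2>0$, $\sigma\in\mathbb{R}^m_+$, $\gamma>0$, and a sequence $\{\tau_k\}_{k\ge0}$ of positive reals with $\tau_k\to0$. At each iteration $k=0,1,2,\ldots$: (Step 1) choose $d(x_k)\in\Omega-x_k$ with $\max_{i\in I}\{\nabla f_i(x_k)^Td(x_k)\}\le-c_1\|s(x_k)\|^2$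 and $\|d(x_k)\|\le c_2\|s(x_k)\|$. (Step 2) For $\ell=0,1,2,\ldots$ put $x_{k,\ell}^+=x_k+\beta^\ell d(x_k)$ and $$[\nu_{k,\ell}]_i=\sigma_i\exp\left(-\frac{\max\{\gamma,\ f_i(x_{k,\ell}^+)-f_i(x_k)\}}{\tau_k}\right),\quad i\in I,$$ and let $\ell_k$ be the first $\ell$ such that $f_i(x_{k,\ell}^+)\le f_i(x_k)+\rho\beta^\ell\nabla f_i(x_k)^Td(x_k)+[\nu_{k,\ell}]_i$ for all $i\in I$. (Step 3) Set $\nu_k=\nu_{k,\ell_k}$, $\alpha_k=\beta^{\ell_k}$, $x_{k+1}=x_{k,\ell_k}^+$. *)

theory Defs
  imports "HOL-Analysis.Analysis"
begin

definition continuously_differentiable ::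
    "('a::real_normed_vector \<Rightarrow> 'b::real_normed_vector) \<Rightarrow> bool" where
  "continuously_differentiable F \<longleftrightarrow>
     (\<exists>F' :: 'a \<Rightarrow> 'a \<Rightarrow>\<^sub>L 'b.
        (\<forall>x. (F has_derivative blinfun_apply (F' x)) (at x)) \<and> continuous_on UNIV F')"

definition gradient :: "('a::real_inner \<Rightarrow> real) \<Rightarrow> 'a \<Rightarrow> 'a" where
  "gradient f x = (THE g. GDERIV f x :> g)"

definition max_slope :: "(real^'n \<Rightarrow> real^'m) \<Rightarrow> real^'n \<Rightarrow> real^'n \<Rightarrow> real" where
  "max_slope F x d = (MAX i. gradient (\<lambda>y. F y $ i) x \<bullet> d)"

definition feasible_directions :: "(real^'n) set \<Rightarrow> real^'n \<Rightarrow> (real^'n) set" where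
  "feasible_directions \<Omega> x = {y. y + x \<in> \<Omega>}"

text \<open>The minimizer exists and is unique whenever \<open>\<Omega>\<close> is nonempty, closed and convex,
  since the objective is continuous and strongly convex.\<close>

definition steepest_direction ::
    "(real^'n) set \<Rightarrow> (real^'n \<Rightarrow> real^'m) \<Rightarrow> real^'n \<Rightarrow> real^'n" where
  "steepest_direction \<Omega> F x =
     (THE d. is_arg_min (\<lambda>d. max_slope F x d + (norm d)\<^sup>2 / 2)
               (\<lambda>d. d \<in> feasible_directions \<Omega> x) d)"

definition metropolis_term ::
    "(real^'n \<Rightarrow> real^'m) \<Rightarrow> real^'m \<Rightarrow> real \<Rightarrow> real \<Rightarrow> real^'n \<Rightarrow> real^'n \<Rightarrow> real^'m" where
  "metropolis_term F \<sigma> \<gamma> \<tau> x y =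
     (\<chi> i. \<sigma> $ i * exp (- (max \<gamma> (F y $ i - F x $ i) / \<tau>)))"

definition metropolis_acceptable ::
    "(real^'n \<Rightarrow> real^'m) \<Rightarrow> real \<Rightarrow> real \<Rightarrow> real^'m \<Rightarrow> real \<Rightarrow> real \<Rightarrow>
     real^'n \<Rightarrow> real^'n \<Rightarrow> nat \<Rightarrow> bool" where
  "metropolis_acceptable F \<beta> \<rho> \<sigma> \<gamma> \<tau> x d l \<longleftrightarrow>
     (\<forall>i. F (x + \<beta> ^ l *\<^sub>R d) $ i \<le>
          F x $ i + \<rho> * \<beta> ^ l * (gradient (\<lambda>y. F y $ i) x \<bullet> d)
            + metropolis_term F \<sigma> \<gamma> \<tau> x (x + \<beta> ^ l *\<^sub>R d) $ i)"

text \<open>The pair \<open>(x, d)\<close> is a run of the method: \<open>d k\<close> is the direction chosen at iteration \<open>k\<close>,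
  and \<open>l\<close> below is the first acceptable backtracking exponent.\<close>

definition metropolis_line_search ::
    "(real^'n) set \<Rightarrow> (real^'n \<Rightarrow> real^'m) \<Rightarrow> real \<Rightarrow> real \<Rightarrow> real \<Rightarrow> real \<Rightarrow> real^'m \<Rightarrow> real \<Rightarrow>
     (nat \<Rightarrow> real) \<Rightarrow> (nat \<Rightarrow> real^'n) \<Rightarrow> (nat \<Rightarrow> real^'n) \<Rightarrow> bool" where
  "metropolis_line_search \<Omega> F \<beta> \<rho> c\<^sub>1 c\<^sub>2 \<sigma> \<gamma> \<tau> x d \<longleftrightarrow>
     x 0 \<in> \<Omega> \<and>
     (\<forall>k. d k \<in> feasible_directions \<Omega> (x k) \<and>
          max_slope F (x k) (d k) \<le> - c\<^sub>1 * (norm (steepest_direction \<Omega> F (x k)))\<^sup>2 \<and>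
          norm (d k) \<le> c\<^sub>2 * norm (steepest_direction \<Omega> F (x k)) \<and>
          (\<exists>l. metropolis_acceptable F \<beta> \<rho> \<sigma> \<gamma> (\<tau> k) (x k) (d k) l \<and>
               (\<forall>j<l. \<not> metropolis_acceptable F \<beta> \<rho> \<sigma> \<gamma> (\<tau> k) (x k) (d k) j) \<and>
               x (Suc k) = x k + \<beta> ^ l *\<^sub>R d k))"

end

theory Submission
  imports Defs
begin

text \<open>Suppose \<open>\<parallel>s(x\<^sub>k)\<parallel> \<ge> \<epsilon> > 0\<close> for all large \<open>k\<close>. By Hoelder continuity of the gradients every
  step length below a threshold depending only on \<open>\<epsilon>\<close> satisfies the monotone Armijo condition, so
  the step lengths stay bounded away from zero. Each iteration then lowers every \<open>f\<^sub>i\<close> by a fixed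
  amount up to the Metropolis term, which is at most \<open>\<sigma>\<^sub>i exp(-\<gamma>/\<tau>\<^sub>k) \<rightarrow> 0\<close>. Hence \<open>f\<^sub>i\<close> tends to
  minus infinity along the iterates, against boundedness from below.\<close>

section \<open>Gradients and Hoelder descent along feasible segments\<close>

text \<open>The Riesz representative of the derivative is its adjoint applied to 1. Uniqueness of
  derivatives then determines the definite description in \<open>gradient\<close>.\<close>

lemma GDERIV_gradient:
  fixes f :: "'a::euclidean_space \<Rightarrow> real"
  assumes "f differentiable (at x)"
  shows "GDERIV f x :> gradient f x"
proof -
  obtain f' where f': "(f has_derivative f') (at x)"
    using assms unfolding differentiable_def by blast
  have "f' = (\<lambda>h. h \<bullet> adjoint f' 1)"
    using adjoint_works[OF has_derivative_linear[OF f'], of _ 1] by auto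
  then have g: "GDERIV f x :> adjoint f' 1"
    using f' unfolding gderiv_def by metis
  have "g' = adjoint f' 1" if "GDERIV f x :> g'" for g'
  proof -
    have "(\<lambda>h. h \<bullet> g') = (\<lambda>h. h \<bullet> adjoint f' 1)"
      using has_derivative_unique that g unfolding gderiv_def by blast
    then show ?thesis
      by (metis vector_eq_ldot)
  qed
  then show ?thesis
    unfolding gradient_def using g theI by metis
qed

lemma convex_segment_direction:
  fixes \<Omega> :: "'a::real_vector set"
  assumes "convex \<Omega>" "x \<in> \<Omega>" "x + d \<in> \<Omega>" "0 \<le> t" "t \<le> 1"
  shows "x + t *\<^sub>R d \<in> \<Omega>"
proof -
  have "x + t *\<^sub>R d = (1 - t) *\<^sub>R x + t *\<^sub>R (x + d)"
    by (simp add: algebra_simps)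
  then show ?thesis
    using convexD_alt[OF assms(1-3), of t] assms(4,5) by simp
qed

text \<open>By the mean value theorem the increment is \<open>t\<close> times a slope at some
  \<open>x + u *\<^sub>R d\<close> with \<open>u < t\<close>. Convexity keeps that point in
  \<open>\<Omega>\<close>, so the Hoelder condition controls how far its gradient is from the one at
  \<open>x\<close>. Avoiding the integral form of the remainder costs only the factor
  \<open>1 / (1 + \<theta>)\<close> in the constant.\<close>

lemma holder_descent:
  fixes f :: "'a::euclidean_space \<Rightarrow> real"
  assumes diff: "\<And>y. f differentiable (at y)"
    and "convex \<Omega>" "x \<in> \<Omega>" "x + d \<in> \<Omega>"
    and holder: "\<And>y z. y \<in> \<Omega> \<Longrightarrow> z \<in> \<Omega> \<Longrightarrow>
          norm (gradient f y - gradient f z) \<le> H * norm (z - y) powr \<theta>"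
    and "0 \<le> \<theta>" "0 \<le> H" "0 < t" "t \<le> 1"
  shows "f (x + t *\<^sub>R d) \<le> f x + t * (gradient f x \<bullet> d) + H * t powr (1 + \<theta>) * norm d powr (1 + \<theta>)"
proof -
  have der: "((\<lambda>u. f (x + u *\<^sub>R d)) has_derivative (\<lambda>h. (h *\<^sub>R d) \<bullet> gradient f (x + u *\<^sub>R d))) (at u)"
    for u :: real
  proof -
    have "((\<lambda>u. x + u *\<^sub>R d) has_derivative (\<lambda>h. h *\<^sub>R d)) (at u)"
      by (auto intro!: derivative_eq_intros)
    from diff_chain_at[OF this] GDERIV_gradient[OF diff]
    show ?thesis
      unfolding gderiv_def o_def by blast
  qed
  obtain u where u: "0 < u" "u < t"
    and mv: "f (x + t *\<^sub>R d) - f (x + 0 *\<^sub>R d) = ((t - 0) *\<^sub>R d) \<bullet> gradient f (x + u *\<^sub>R d)"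
    using mvt_simple[OF \<open>0 < t\<close> has_derivative_at_withinI[OF der]] by auto
  have "x + u *\<^sub>R d \<in> \<Omega>"
    using convex_segment_direction assms u by force
  then have "norm (gradient f (x + u *\<^sub>R d) - gradient f x) \<le> H * norm (u *\<^sub>R d) powr \<theta>"
    using holder[of "x + u *\<^sub>R d" x] \<open>x \<in> \<Omega>\<close> by simp
  also have "\<dots> \<le> H * (t * norm d) powr \<theta>"
    using u \<open>0 \<le> H\<close> \<open>0 \<le> \<theta>\<close> by (auto intro!: mult_left_mono powr_mono2 mult_right_mono)
  finally have g: "norm (gradient f (x + u *\<^sub>R d) - gradient f x) \<le> H * (t * norm d) powr \<theta>" .
  have "(gradient f (x + u *\<^sub>R d) - gradient f x) \<bullet> d \<le> H * (t * norm d) powr \<theta> * norm d"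
    using norm_cauchy_schwarz[of "gradient f (x + u *\<^sub>R d) - gradient f x" d]
      mult_right_mono[OF g norm_ge_zero[of d]] by linarith
  then have "t * ((gradient f (x + u *\<^sub>R d) - gradient f x) \<bullet> d)
      \<le> t * (H * (t * norm d) powr \<theta> * norm d)"
    using \<open>0 < t\<close> by simp
  also have "\<dots> = H * t powr (1 + \<theta>) * norm d powr (1 + \<theta>)"
    using \<open>0 < t\<close> by (cases "d = 0") (simp_all add: powr_add powr_mult)
  finally show ?thesis
    using mv by (simp add: algebra_simps inner_commute)
qed

text \<open>For \<open>s\<close> at least \<open>\<epsilon>\<close>, the Hoelder remainder is at
  most \<open>t * s\<^sup>2 * (C * t powr \<theta>)\<close>, while the slope term is at least of
  order \<open>t * s\<^sup>2\<close>. The remainder is thus absorbed by the fraction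
  \<open>1 - \<rho>\<close> of the slope once \<open>t\<close> is small, uniformly in the point and
  the direction. Later \<open>s\<close> is the norm of the steepest direction.\<close>

lemma armijo_threshold:
  fixes f :: "'a::euclidean_space \<Rightarrow> real"
  assumes diff: "\<And>y. f differentiable (at y)"
    and "convex \<Omega>"
    and holder: "\<And>y z. y \<in> \<Omega> \<Longrightarrow> z \<in> \<Omega> \<Longrightarrow>
          norm (gradient f y - gradient f z) \<le> H * norm (z - y) powr \<theta>"
    and \<theta>: "0 < \<theta>" "\<theta> \<le> 1"
    and pos: "\<rho> < 1" "0 < c\<^sub>1" "0 < c\<^sub>2" "0 < \<epsilon>"
  shows "\<exists>T>0. \<forall>x d s t. x \<in> \<Omega> \<longrightarrow> x + d \<in> \<Omega> \<longrightarrow> \<epsilon> \<le> s \<longrightarrow> norm d \<le> c\<^sub>2 * s \<longrightarrow>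
           gradient f x \<bullet> d \<le> - c\<^sub>1 * s\<^sup>2 \<longrightarrow> 0 < t \<longrightarrow> t \<le> 1 \<longrightarrow> t \<le> T \<longrightarrow>
           f (x + t *\<^sub>R d) \<le> f x + \<rho> * t * (gradient f x \<bullet> d)"
proof -
  \<comment> \<open>The Hoelder constant comes without a sign; a positive one makes \<open>C\<close>
    positive, so that dividing by it is safe.\<close>
  define H' where "H' = \<bar>H\<bar> + 1"
  define C where "C = H' * c\<^sub>2 powr (1 + \<theta>) * \<epsilon> powr (\<theta> - 1)"
  \<comment> \<open>\<open>T\<close> solves
    \<open>C * T powr \<theta> = (1 - \<rho>) * c\<^sub>1\<close>.\<close>
  define T where "T = ((1 - \<rho>) * c\<^sub>1 / C) powr (1 / \<theta>)"
  have "H' > 0"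
    unfolding H'_def by linarith
  then have "C > 0"
    unfolding C_def using pos by simp
  then have q: "(1 - \<rho>) * c\<^sub>1 / C > 0"
    using pos by simp
  then have "T > 0"
    unfolding T_def by (metis less_irrefl powr_gt_zero)
  have holder': "norm (gradient f y - gradient f z) \<le> H' * norm (z - y) powr \<theta>"
    if "y \<in> \<Omega>" "z \<in> \<Omega>" for y z
    using holder[OF that] mult_right_mono[of H H' "norm (z - y) powr \<theta>"]
    unfolding H'_def by fastforce
  have "f (x + t *\<^sub>R d) \<le> f x + \<rho> * t * (gradient f x \<bullet> d)"
    if "x \<in> \<Omega>" "x + d \<in> \<Omega>" and s: "\<epsilon> \<le> s" "norm d \<le> c\<^sub>2 * s"
      and slope: "gradient f x \<bullet> d \<le> - c\<^sub>1 * s\<^sup>2" and t: "0 < t" "t \<le> 1" "t \<le> T" for x d s t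
  proof -
    have "s > 0"
      using s pos by linarith
    have "t powr \<theta> \<le> T powr \<theta>"
      using t \<theta> by (intro powr_mono2) auto
    also have "\<dots> = (1 - \<rho>) * c\<^sub>1 / C"
      unfolding T_def powr_powr using \<theta> pos \<open>C > 0\<close> by (simp add: abs_mult)
    finally have tC: "C * t powr \<theta> \<le> (1 - \<rho>) * c\<^sub>1"
      using \<open>C > 0\<close> by (simp add: field_simps)
    have "s powr (1 + \<theta>) = s powr (2 + (\<theta> - 1))"
      by simp
    also have "\<dots> = s\<^sup>2 * s powr (\<theta> - 1)"
      unfolding powr_add using \<open>s > 0\<close> by simp
    \<comment> \<open>The exponent \<open>\<theta> - 1\<close> is not positive, so the power is
      antitone and the lower bound on \<open>s\<close> gives an upper bound.\<close>
    also have "\<dots> \<le> s\<^sup>2 * \<epsilon> powr (\<theta> - 1)"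
      using \<theta> s pos by (intro mult_left_mono powr_mono2') auto
    finally have sp: "s powr (1 + \<theta>) \<le> s\<^sup>2 * \<epsilon> powr (\<theta> - 1)" .
    have "norm d powr (1 + \<theta>) \<le> (c\<^sub>2 * s) powr (1 + \<theta>)"
      using s \<theta> by (intro powr_mono2) auto
    also have "\<dots> = c\<^sub>2 powr (1 + \<theta>) * s powr (1 + \<theta>)"
      using pos \<open>s > 0\<close> by (simp add: powr_mult)
    also have "\<dots> \<le> c\<^sub>2 powr (1 + \<theta>) * (s\<^sup>2 * \<epsilon> powr (\<theta> - 1))"
      using sp by (intro mult_left_mono) auto
    finally have "H' * t powr (1 + \<theta>) * norm d powr (1 + \<theta>)
        \<le> H' * t powr (1 + \<theta>) * (c\<^sub>2 powr (1 + \<theta>) * (s\<^sup>2 * \<epsilon> powr (\<theta> - 1)))"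
      using \<open>H' > 0\<close> by (intro mult_left_mono) auto
    also have "\<dots> = t * s\<^sup>2 * (C * t powr \<theta>)"
      unfolding C_def powr_add[of t] using t by simp
    also have "\<dots> \<le> t * s\<^sup>2 * ((1 - \<rho>) * c\<^sub>1)"
      using tC t by (intro mult_left_mono) auto
    also have "\<dots> = (1 - \<rho>) * t * (c\<^sub>1 * s\<^sup>2)"
      by simp
    also have "\<dots> \<le> (1 - \<rho>) * t * (- (gradient f x \<bullet> d))"
      using slope t pos by (intro mult_left_mono) auto
    finally show ?thesis
      using holder_descent[OF diff \<open>convex \<Omega>\<close> that(1,2) holder' _ _ t(1,2)] \<theta> \<open>H' > 0\<close>
      by (simp add: algebra_simps)
  qed
  with \<open>T > 0\<close> show ?thesis
    by blast
qed

lemma gradient_le_max_slope: "gradient (\<lambda>y. F y $ i) x \<bullet> d \<le> max_slope F x d"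
  unfolding max_slope_def by (rule Max_ge) auto

section \<open>Size of the Metropolis term\<close>

text \<open>The maximum in the exponent is at least \<open>\<gamma>\<close>, which gives a bound
  independent of the two points compared.\<close>

lemma metropolis_term_bounds:
  assumes "\<sigma> $ i \<ge> 0" "\<tau> > 0"
  shows "0 \<le> metropolis_term F \<sigma> \<gamma> \<tau> x y $ i"
    and "metropolis_term F \<sigma> \<gamma> \<tau> x y $ i \<le> \<sigma> $ i * exp (- (\<gamma> / \<tau>))"
  using assms unfolding metropolis_term_def
  by (auto intro!: mult_left_mono divide_right_mono)

lemma exp_neg_divide_tendsto_0:
  fixes \<tau> :: "nat \<Rightarrow> real"
  assumes "\<gamma> > 0" "\<And>k. \<tau> k > 0" "\<tau> \<longlonglongrightarrow> 0"
  shows "(\<lambda>k. exp (- (\<gamma> / \<tau> k))) \<longlonglongrightarrow> 0"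
proof -
  have "filterlim \<tau> (at_right 0) sequentially"
    using assms by (intro tendsto_imp_filterlim_at_right) auto
  then have "filterlim (\<lambda>k. \<gamma> / \<tau> k) at_top sequentially"
    unfolding divide_inverse using assms(1)
    by (intro filterlim_tendsto_pos_mult_at_top[OF tendsto_const])
      (auto intro: filterlim_compose[OF filterlim_inverse_at_top_right])
  then show ?thesis
    by (auto intro!: filterlim_compose[OF exp_at_bot] simp: filterlim_uminus_at_bot)
qed

section \<open>Real sequences: fixed decrements and lower limits\<close>

lemma decrement_unbounded_below:
  fixes a :: "nat \<Rightarrow> real"
  assumes "\<delta> > 0" "eventually (\<lambda>k. a (Suc k) \<le> a k - \<delta>) sequentially"
  shows "\<exists>k. a k < b"
proof -
  obtain K where K: "\<And>k. k \<ge> K \<Longrightarrow> a (Suc k) \<le> a k - \<delta>"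
    using assms(2) unfolding eventually_sequentially by blast
  have "a (K + n) \<le> a K - real n * \<delta>" for n
  proof (induction n)
    case (Suc n)
    with K[of "K + n"] show ?case
      by (simp add: algebra_simps)
  qed simp
  moreover obtain n where "real n * \<delta> > a K - b"
    using reals_Archimedean3[OF \<open>\<delta> > 0\<close>] by blast
  ultimately have "a (K + n) < b"
    by (smt (verit))
  then show ?thesis
    by blast
qed

text \<open>A positive lower limit would leave room for a real \<open>\<epsilon>\<close> strictly
  between 0 and it, and the sequence would eventually stay above \<open>\<epsilon>\<close>.\<close>

lemma liminf_nonneg_eq_0:
  fixes a :: "nat \<Rightarrow> real"
  assumes "\<And>k. a k \<ge> 0"
    and "\<And>\<epsilon>. \<epsilon> > 0 \<Longrightarrow> \<not> eventually (\<lambda>k. \<epsilon> \<le> a k) sequentially"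
  shows "liminf (\<lambda>k. ereal (a k)) = 0"
proof (rule ccontr)
  assume "liminf (\<lambda>k. ereal (a k)) \<noteq> 0"
  moreover have "0 \<le> liminf (\<lambda>k. ereal (a k))"
    using assms(1) by (intro Liminf_bounded) auto
  ultimately have "0 < liminf (\<lambda>k. ereal (a k))"
    by simp
  then obtain \<epsilon> where "0 < ereal \<epsilon>" "ereal \<epsilon> < liminf (\<lambda>k. ereal (a k))"
    using ereal_dense2 by blast
  moreover from this have "eventually (\<lambda>k. \<epsilon> \<le> a k) sequentially"
    by (auto dest!: less_LiminfD elim: eventually_mono)
  ultimately show False
    using assms(2) by simp
qed

theorem theorem5p2:
  fixes \<Omega> :: "(real^'n) set"
    and F :: "real^'n \<Rightarrow> real^'m"
    and \<beta> \<rho> c\<^sub>1 c\<^sub>2 \<gamma> :: real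
    and \<sigma> :: "real^'m"
    and \<tau> :: "nat \<Rightarrow> real"
    and x d :: "nat \<Rightarrow> real^'n"
  assumes "\<Omega> \<noteq> {}" and "closed \<Omega>" and "convex \<Omega>"
    and "continuously_differentiable F"
    and "0 < \<beta>" and "\<beta> < 1" and "0 < \<rho>" and "\<rho> < 1"
    and "c\<^sub>1 > 0" and "c\<^sub>2 > 0"
    and "\<And>i. \<sigma> $ i \<ge> 0" and "\<gamma> > 0"
    and "\<And>k. \<tau> k > 0" and "\<tau> \<longlonglongrightarrow> 0"
    and holder: "\<And>i. \<exists>\<theta> H. 0 < \<theta> \<and> \<theta> \<le> 1 \<and>
           (\<forall>x\<in>\<Omega>. \<forall>y\<in>\<Omega>.
              norm (gradient (\<lambda>z. F z $ i) x - gradient (\<lambda>z. F z $ i) y)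
                \<le> H * norm (y - x) powr \<theta>)"
    and bounded_below: "\<And>i. \<exists>f_star. \<forall>x\<in>\<Omega>. F x $ i \<ge> f_star"
    and run: "metropolis_line_search \<Omega> F \<beta> \<rho> c\<^sub>1 c\<^sub>2 \<sigma> \<gamma> \<tau> x d"
  shows "(\<exists>k. d k = 0) \<or>
         liminf (\<lambda>k. ereal (norm (steepest_direction \<Omega> F (x k)))) = 0"
\<comment> \<open>The second alternative can be shown for every run: if \<open>d k = 0\<close>, the
  slope condition forces the steepest direction at \<open>x k\<close> to vanish, and the iterates
  stay there.\<close>
proof (rule disjI2, rule liminf_nonneg_eq_0)
  show "norm (steepest_direction \<Omega> F (x k)) \<ge> 0" for k
    by simp
next
  fix \<epsilon> :: real
  assume "\<epsilon> > 0"
  define s where "s k = norm (steepest_direction \<Omega> F (x k))" for k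
  have diff: "(\<lambda>y. F y $ i) differentiable (at y)" for i y
  proof -
    have "F differentiable (at y)"
      using \<open>continuously_differentiable F\<close>
      unfolding continuously_differentiable_def differentiable_def by blast
    then show ?thesis
      unfolding differentiable_def
      using bounded_linear.has_derivative[OF bounded_linear_vec_nth] by blast
  qed
  have x0: "x 0 \<in> \<Omega>" and feas: "\<And>k. x k + d k \<in> \<Omega>"
    and max_le: "\<And>k. max_slope F (x k) (d k) \<le> - c\<^sub>1 * (s k)\<^sup>2"
    and norm_d: "\<And>k. norm (d k) \<le> c\<^sub>2 * s k"
    using run unfolding metropolis_line_search_def feasible_directions_def s_def
    by (auto simp: add.commute)
  have slope: "gradient (\<lambda>y. F y $ i) (x k) \<bullet> d k \<le> - c\<^sub>1 * (s k)\<^sup>2" for k i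
    using order_trans[OF gradient_le_max_slope max_le] .
  obtain l where acc: "\<And>k. metropolis_acceptable F \<beta> \<rho> \<sigma> \<gamma> (\<tau> k) (x k) (d k) (l k)"
    and first: "\<And>k j. j < l k \<Longrightarrow> \<not> metropolis_acceptable F \<beta> \<rho> \<sigma> \<gamma> (\<tau> k) (x k) (d k) j"
    and step: "\<And>k. x (Suc k) = x k + \<beta> ^ l k *\<^sub>R d k"
    using run unfolding metropolis_line_search_def by metis
  have pow: "0 < \<beta> ^ j" "\<beta> ^ j \<le> 1" for j
    using \<open>0 < \<beta>\<close> \<open>\<beta> < 1\<close> by (auto intro: power_le_one)
  have x_in: "x k \<in> \<Omega>" for k
  proof (induction k)
    case (Suc k)
    then show ?case
      using convex_segment_direction[OF \<open>convex \<Omega>\<close> _ feas] pow step by (simp add: less_imp_le)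
  qed (rule x0)
  have "\<exists>T>0. \<forall>x d s t. x \<in> \<Omega> \<longrightarrow> x + d \<in> \<Omega> \<longrightarrow> \<epsilon> \<le> s \<longrightarrow> norm d \<le> c\<^sub>2 * s \<longrightarrow>
           gradient (\<lambda>y. F y $ i) x \<bullet> d \<le> - c\<^sub>1 * s\<^sup>2 \<longrightarrow> 0 < t \<longrightarrow> t \<le> 1 \<longrightarrow> t \<le> T \<longrightarrow>
           F (x + t *\<^sub>R d) $ i \<le> F x $ i + \<rho> * t * (gradient (\<lambda>y. F y $ i) x \<bullet> d)" for i
  proof -
    obtain \<theta> H where "0 < \<theta>" "\<theta> \<le> 1"
      and "\<And>y z. y \<in> \<Omega> \<Longrightarrow> z \<in> \<Omega> \<Longrightarrow>
        norm (gradient (\<lambda>z. F z $ i) y - gradient (\<lambda>z. F z $ i) z) \<le> H * norm (z - y) powr \<theta>"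
      using holder by meson
    then show ?thesis
      using armijo_threshold[OF diff \<open>convex \<Omega>\<close>] \<open>\<rho> < 1\<close> \<open>c\<^sub>1 > 0\<close> \<open>c\<^sub>2 > 0\<close> \<open>\<epsilon> > 0\<close> by blast
  qed
  then obtain T where T_pos: "\<And>i. T i > 0"
    and armijo: "\<And>i x d s t. x \<in> \<Omega> \<Longrightarrow> x + d \<in> \<Omega> \<Longrightarrow> \<epsilon> \<le> s \<Longrightarrow> norm d \<le> c\<^sub>2 * s \<Longrightarrow>
           gradient (\<lambda>y. F y $ i) x \<bullet> d \<le> - c\<^sub>1 * s\<^sup>2 \<Longrightarrow> 0 < t \<Longrightarrow> t \<le> 1 \<Longrightarrow> t \<le> T i \<Longrightarrow>
           F (x + t *\<^sub>R d) $ i \<le> F x $ i + \<rho> * t * (gradient (\<lambda>y. F y $ i) x \<bullet> d)"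
    by metis
  \<comment> \<open>The index type is finite, so one positive threshold serves all
    components.\<close>
  define T\<^sub>0 where "T\<^sub>0 = Min (range T)"
  \<comment> \<open>Either the full step 1 is accepted, or the last rejected step exceeds
    \<open>T\<^sub>0\<close> and the accepted one is \<open>\<beta>\<close> times it.\<close>
  define \<alpha> where "\<alpha> = min 1 (\<beta> * T\<^sub>0)"
  have "T\<^sub>0 > 0"
    unfolding T\<^sub>0_def using T_pos by auto
  then have "\<alpha> > 0"
    unfolding \<alpha>_def using \<open>0 < \<beta>\<close> by simp
  have T\<^sub>0_le: "T\<^sub>0 \<le> T i" for i
    unfolding T\<^sub>0_def by simp
  have alpha_le: "\<alpha> \<le> \<beta> ^ l k" if "\<epsilon> \<le> s k" for k
  proof (cases "l k")
    case 0
    then show ?thesis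
      unfolding \<alpha>_def by simp
  next
    case (Suc j)
    have "\<not> \<beta> ^ j \<le> T\<^sub>0"
    proof
      assume "\<beta> ^ j \<le> T\<^sub>0"
      have "metropolis_acceptable F \<beta> \<rho> \<sigma> \<gamma> (\<tau> k) (x k) (d k) j"
        unfolding metropolis_acceptable_def
      proof
        fix i
        have "F (x k + \<beta> ^ j *\<^sub>R d k) $ i
            \<le> F (x k) $ i + \<rho> * \<beta> ^ j * (gradient (\<lambda>y. F y $ i) (x k) \<bullet> d k)"
          using armijo[OF x_in feas that norm_d slope] pow T\<^sub>0_le[of i] \<open>\<beta> ^ j \<le> T\<^sub>0\<close> by simp
        \<comment> \<open>The Metropolis term is nonnegative, so it only relaxes the monotone Armijo
          test.\<close>
        then show "F (x k + \<beta> ^ j *\<^sub>R d k) $ i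
            \<le> F (x k) $ i + \<rho> * \<beta> ^ j * (gradient (\<lambda>y. F y $ i) (x k) \<bullet> d k)
              + metropolis_term F \<sigma> \<gamma> (\<tau> k) (x k) (x k + \<beta> ^ j *\<^sub>R d k) $ i"
          using metropolis_term_bounds(1) assms(11,13) by (metis add_increasing2)
      qed
      with first Suc show False
        by simp
    qed
    then have "\<beta> * T\<^sub>0 \<le> \<beta> ^ l k"
      using Suc \<open>0 < \<beta>\<close> by simp
    then show ?thesis
      unfolding \<alpha>_def by simp
  qed
  \<comment> \<open>Any single component yields the contradiction.\<close>
  fix i :: 'm
  \<comment> \<open>The Armijo decrease guaranteed by a step of at least \<open>\<alpha>\<close> and
    a slope of at most \<open>- c\<^sub>1 * \<epsilon>\<^sup>2\<close>.\<close>
  define \<delta> where "\<delta> = \<rho> * \<alpha> * (c\<^sub>1 * \<epsilon>\<^sup>2)"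
  have "\<delta> > 0"
    unfolding \<delta>_def using \<open>\<alpha> > 0\<close> \<open>0 < \<rho>\<close> \<open>c\<^sub>1 > 0\<close> \<open>\<epsilon> > 0\<close> by simp
  have decrease: "F (x (Suc k)) $ i \<le> F (x k) $ i - \<delta> + \<sigma> $ i * exp (- (\<gamma> / \<tau> k))"
    if "\<epsilon> \<le> s k" for k
  proof -
    have "\<epsilon>\<^sup>2 \<le> (s k)\<^sup>2"
      using that \<open>\<epsilon> > 0\<close> by (intro power_mono) auto
    then have "c\<^sub>1 * \<epsilon>\<^sup>2 \<le> c\<^sub>1 * (s k)\<^sup>2"
      using \<open>c\<^sub>1 > 0\<close> by simp
    also have "\<dots> \<le> - (gradient (\<lambda>y. F y $ i) (x k) \<bullet> d k)"
      using slope[of i k] by simp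
    finally have "\<delta> \<le> \<rho> * \<beta> ^ l k * - (gradient (\<lambda>y. F y $ i) (x k) \<bullet> d k)"
      unfolding \<delta>_def using alpha_le[OF that] \<open>\<alpha> > 0\<close> \<open>0 < \<rho>\<close> \<open>c\<^sub>1 > 0\<close> pow
      by (intro mult_mono) (auto intro: less_imp_le)
    moreover have "F (x (Suc k)) $ i
        \<le> F (x k) $ i + \<rho> * \<beta> ^ l k * (gradient (\<lambda>y. F y $ i) (x k) \<bullet> d k)
          + metropolis_term F \<sigma> \<gamma> (\<tau> k) (x k) (x (Suc k)) $ i"
      using acc[of k] unfolding metropolis_acceptable_def step by blast
    ultimately show ?thesis
      using metropolis_term_bounds(2)[OF assms(11,13), of F \<gamma> k "x k" "x (Suc k)" i] by simp
  qed
  have "(\<lambda>k. \<sigma> $ i * exp (- (\<gamma> / \<tau> k))) \<longlonglongrightarrow> 0"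
    using exp_neg_divide_tendsto_0[OF \<open>\<gamma> > 0\<close> assms(13,14)] by (rule tendsto_mult_right_zero)
  \<comment> \<open>The perturbation eventually uses up less than half of \<open>\<delta>\<close>,
    leaving a net decrease of \<open>\<delta> / 2\<close> per iteration; its convergence to 0
    suffices, without summability.\<close>
  then have small: "eventually (\<lambda>k. \<sigma> $ i * exp (- (\<gamma> / \<tau> k)) < \<delta> / 2) sequentially"
    using \<open>\<delta> > 0\<close> by (intro order_tendstoD) auto
  obtain b where b: "\<And>y. y \<in> \<Omega> \<Longrightarrow> b \<le> F y $ i"
    using bounded_below by blast
  show "\<not> eventually (\<lambda>k. \<epsilon> \<le> norm (steepest_direction \<Omega> F (x k))) sequentially"
  proof
    assume "eventually (\<lambda>k. \<epsilon> \<le> norm (steepest_direction \<Omega> F (x k))) sequentially"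
    with small have "eventually (\<lambda>k. F (x (Suc k)) $ i \<le> F (x k) $ i - \<delta> / 2) sequentially"
    proof eventually_elim
      case (elim k)
      then show ?case
        using decrease[of k] unfolding s_def by linarith
    qed
    then obtain k where "F (x k) $ i < b"
      using decrement_unbounded_below[of "\<delta> / 2" "\<lambda>k. F (x k) $ i" b] \<open>\<delta> > 0\<close> by auto
    with b[OF x_in[of k]] show False
      by simp
  qed
qed

end
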